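(* Let $p\in[1,\infty]$, let $x:[0,\infty)\to\mathbb{R}$ be continuous, and let $\Pi=(\pi_n)_n$ be a sequence of partitions of $[0,\infty)$ such that $O_t(x,\pi_n)\to0$ as $n\to\infty$ for all $t\in[0,\infty)$. Let $\tau:[0,\infty)\to[0,\infty)$ be an increasing (i.e. nondecreasing) càdlàg function such that $x\circ\tau$ is continuous and $\tau(0)=0$. For a partition $\pi=(t_j)_j$ let $\tau_\pi$ denote the partition $(\tau_{t_j})_j$, and let $\tau(\Pi):=(\tau_{\pi_n})_n$. If $O_{\tau_t}(x,\tau_{\pi_n})\to0$ for all $t\in[0,\infty)$ and $x\in\mathcal{L}_p^{\tau(\Pi)}$, then $O_t(x\circ\tau,\pi_n)\to0$ for all $t\in[0,\infty)$, $x\circ\tau\in\mathcal{L}_p^\Pi$, and the pathwise local times are related by $$L^{x\circ\tau,\Pi}_t(u)=L^{x,\tau(\Pi)}_{\tau_t}(u).$$ Moreover, if $\tau$ is bijective (i.e. strictly increasing, continuous, $\tau(0)=0$, $\lim_{t\to\infty}\tau(t)=\infty$), then $x\circ\tau$ is continuous, $O_{\tau^{-1}_t}(x\circ\tau,\tau^{-1}_\pi)=O_t(x,\pi)$ for any partition $\pi$ of $[0,\infty)$ and any $t$, and if $P$ is a partition of $\mathbb{R}$ then the Lebesgue partitions of $x\circ\tau$ and $x$ satisfy $\pi_P(x\circ\tau)=\tau^{-1}_{\pi_P(x)}$.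
   Context: A partition of $[0,\infty)$ is a sequence $\pi=(t_k)_{k\in\mathbb{N}}$ in $[0,\infty]$ with $t_0=0$, $t_k<t_{k+1}$ whenever $t_{k+1}<\infty$, and $\lim_k t_k=\infty$. For $\tau_\pi$ we set $\tau_\infty:=\infty$ and repeated points are discarded (they contribute nothing to any of the quantities below); it is implicit that $\tau_{\pi_n}$ is a partition of $[0,\infty)$ in this sense. For continuous $x$, $O_t(x,\pi):=\max\{|x(b)-x(a)|:a,b\in[t_k,t_{k+1})\cap[0,t]\text{ for some }k\}$ (understood as a supremum). For $a,b\in\mathbb{R}$ let $[\![a,b)\!)$ denote $[a,b)$ if $a\le b$ and $[b,a)$ if $a>b$. The discrete local time of $x$ along $\pi$ is $$L^{x,\pi}_t(u):=2\sum_{t_j\in\pi}\mathbf{1}_{[\![x_{t_j\wedge t},\,x_{t_{j+1}\wedge t})\!)}(u)\,|x_{t_{j+1}\wedge t}-u|.$$ For a sequence of partitions $\Pi=(\pi_n)_n$, $\mathcal{L}_p^\Pi$ is the set of continuous $x:[0,\infty)\to\mathbb{R}$ with $O_t(x,\pi_n)\to0$ for all $t$ such that, for all $t\in[0,\infty)$, $(L^{x,\pi_n}_t)_n$ converges weakly in $L^p(\mathbb{R},du)$ (weakly$^*$ in $L^\infty$ if $p=\infty$) to some $L^{x,\Pi}_t\in L^p$, and $t\mapsto L^{x,\Pi}_t\in L^p$ is continuous for the weak (resp. weak$^*$) topology. $L^{x,\Pi}_t(u)$ is called the pathwise local time of $x$ along $\Pi$; identities between local times are identities of elements of $L^p$ for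 each $t$. A partition of $\mathbb{R}$ is $P=(p_k)_{k\in\mathbb{Z}}$ with $p_k\in[-\infty,\infty]$, $\lim_{k\to\pm\infty}p_k=\pm\infty$, $p_0=0$, and $p_k<p_{k+1}$ if $p_k,p_{k+1}\in\mathbb{R}$. The Lebesgue partition $\pi_P(x)=(t_k)_k$ is defined by $t_0:=0$, $t_{k+1}:=\inf\{t>t_k:x_t\in P,\ x_t\ne x_{t_k}\}$ (with $\inf\emptyset=\infty$). *)

theory Defs
  imports "HOL-Analysis.Analysis"
begin

text \<open>
  Paths and time changes are functions \<^typ>\<open>real \<Rightarrow> real\<close> of which only the values on
  \<^term>\<open>{0::real..}\<close> matter.
\<close>

definition is_partition :: "(nat \<Rightarrow> ereal) \<Rightarrow> bool" where
  "is_partition \<pi> \<longleftrightarrow>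
     \<pi> 0 = 0 \<and> (\<forall>k. \<pi> (Suc k) < \<infinity> \<longrightarrow> \<pi> k < \<pi> (Suc k)) \<and> \<pi> \<longlonglongrightarrow> \<infinity>"

definition is_real_partition :: "(int \<Rightarrow> ereal) \<Rightarrow> bool" where
  "is_real_partition P \<longleftrightarrow>
     (P \<longlongrightarrow> \<infinity>) at_top \<and> (P \<longlongrightarrow> -\<infinity>) at_bot \<and> P 0 = 0 \<and>
     (\<forall>k. \<bar>P k\<bar> \<noteq> \<infinity> \<and> \<bar>P (k + 1)\<bar> \<noteq> \<infinity> \<longrightarrow> P k < P (k + 1))"

text \<open>Once a point is \<^term>\<open>\<infinity> :: ereal\<close>, the set below is empty and all later points
  are \<^term>\<open>\<infinity> :: ereal\<close> as well.\<close>

primrec lebesgue_partition :: "(int \<Rightarrow> ereal) \<Rightarrow> (real \<Rightarrow> real) \<Rightarrow> nat \<Rightarrow> ereal" where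
  "lebesgue_partition P x 0 = 0"
| "lebesgue_partition P x (Suc k) =
     Inf {ereal t | t. lebesgue_partition P x k < ereal t \<and> ereal (x t) \<in> range P \<and>
                       x t \<noteq> x (real_of_ereal (lebesgue_partition P x k))}"

definition cadlag :: "(real \<Rightarrow> real) \<Rightarrow> bool" where
  "cadlag f \<longleftrightarrow>
     (\<forall>t\<ge>0. continuous (at_right t) f) \<and> (\<forall>t>0. \<exists>l. (f \<longlongrightarrow> l) (at_left t))"

definition time_ext :: "(real \<Rightarrow> real) \<Rightarrow> ereal \<Rightarrow> ereal" where
  "time_ext \<tau> s = (if s = \<infinity> then \<infinity> else ereal (\<tau> (real_of_ereal s)))"

text \<open>
  The image of a partition under a nondecreasing time change, with repeated points discarded:
  each point is the next one strictly above its predecessor among the \<open>\<tau>(t\<^sub>j)\<close>, and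
  \<^term>\<open>\<infinity> :: ereal\<close> if there is none.
\<close>

primrec time_change :: "(real \<Rightarrow> real) \<Rightarrow> (nat \<Rightarrow> ereal) \<Rightarrow> nat \<Rightarrow> ereal" where
  "time_change \<tau> \<pi> 0 = time_ext \<tau> (\<pi> 0)"
| "time_change \<tau> \<pi> (Suc k) =
     Inf {time_ext \<tau> (\<pi> j) | j. time_change \<tau> \<pi> k < time_ext \<tau> (\<pi> j)}"

definition osc :: "real \<Rightarrow> (real \<Rightarrow> real) \<Rightarrow> (nat \<Rightarrow> ereal) \<Rightarrow> real" where
  "osc t x \<pi> =
     Sup {\<bar>x b - x a\<bar> | a b. a \<in> {0..t} \<and> b \<in> {0..t} \<and>
            (\<exists>k. ereal a \<in> {\<pi> k..<\<pi> (Suc k)} \<and> ereal b \<in> {\<pi> k..<\<pi> (Suc k)})}"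

definition between :: "real \<Rightarrow> real \<Rightarrow> real set" where
  "between a b = (if a \<le> b then {a..<b} else {b..<a})"

definition stopped :: "(real \<Rightarrow> real) \<Rightarrow> real \<Rightarrow> ereal \<Rightarrow> real" where
  "stopped x t s = x (real_of_ereal (min s (ereal t)))"

text \<open>For a partition, all but finitely many terms of the series vanish.\<close>

definition discrete_local_time ::
    "(nat \<Rightarrow> ereal) \<Rightarrow> (real \<Rightarrow> real) \<Rightarrow> real \<Rightarrow> real \<Rightarrow> real" where
  "discrete_local_time \<pi> x t u =
     2 * (\<Sum>j. indicator (between (stopped x t (\<pi> j)) (stopped x t (\<pi> (Suc j)))) u *
              \<bar>stopped x t (\<pi> (Suc j)) - u\<bar>)"

text \<open>
  Elements of \<open>L\<^sup>p\<close> are represented by Borel functions, not by equivalence classes. The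
  topology below is therefore the pullback of the weak topology along the quotient map:
  functions that agree almost everywhere are topologically indistinguishable, and
  convergence and continuity mean the same as for the classes.
\<close>

definition Lp :: "ennreal \<Rightarrow> (real \<Rightarrow> real) set" where
  "Lp p = {f \<in> borel_measurable lborel.
     if p = \<infinity> then \<exists>C. AE u in lborel. \<bar>f u\<bar> \<le> C
     else integrable lborel (\<lambda>u. \<bar>f u\<bar> powr enn2real p)}"

text \<open>Only used for finite exponents.\<close>

definition Lp_norm :: "ennreal \<Rightarrow> (real \<Rightarrow> real) \<Rightarrow> real" where
  "Lp_norm p f = (\<integral>u. \<bar>f u\<bar> powr enn2real p \<partial>lborel) powr (1 / enn2real p)"

definition Lp_dual :: "ennreal \<Rightarrow> ((real \<Rightarrow> real) \<Rightarrow> real) set" where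
  "Lp_dual p = {\<phi>.
     (\<forall>f\<in>Lp p. \<forall>g\<in>Lp p. \<phi> (\<lambda>u. f u + g u) = \<phi> f + \<phi> g) \<and>
     (\<forall>c. \<forall>f\<in>Lp p. \<phi> (\<lambda>u. c * f u) = c * \<phi> f) \<and>
     (\<exists>C. \<forall>f\<in>Lp p. \<bar>\<phi> f\<bar> \<le> C * Lp_norm p f)}"

text \<open>
  The functionals inducing the weak topology for finite \<open>p\<close>, and for \<open>p = \<infinity>\<close> the weak-star
  topology of \<open>L\<^sup>\<infinity>\<close> as the dual of \<open>L\<^sup>1\<close>.
\<close>

definition test_functionals :: "ennreal \<Rightarrow> ((real \<Rightarrow> real) \<Rightarrow> real) set" where
  "test_functionals p =
     (if p = \<infinity> then {\<lambda>f. \<integral>u. f u * g u \<partial>lborel | g. g \<in> Lp 1} else Lp_dual p)"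

definition weak_Lp :: "ennreal \<Rightarrow> (real \<Rightarrow> real) topology" where
  "weak_Lp p =
     topology_generated_by {{f \<in> Lp p. \<phi> f \<in> U} | \<phi> U. \<phi> \<in> test_functionals p \<and> open U}"

definition local_time_paths :: "ennreal \<Rightarrow> (nat \<Rightarrow> nat \<Rightarrow> ereal) \<Rightarrow> (real \<Rightarrow> real) set" where
  "local_time_paths p \<pi>s = {x.
     continuous_on {0..} x \<and>
     (\<forall>t\<ge>0. (\<lambda>n. osc t x (\<pi>s n)) \<longlonglongrightarrow> 0) \<and>
     (\<exists>L. (\<forall>t\<ge>0. limitin (weak_Lp p) (\<lambda>n. discrete_local_time (\<pi>s n) x t) (L t) sequentially) \<and>
          continuous_map (top_of_set {0..}) (weak_Lp p) L)}"

text \<open>The limit is unique only up to null sets, so identities between local times are to be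
  stated almost everywhere.\<close>

definition local_time ::
    "ennreal \<Rightarrow> (nat \<Rightarrow> nat \<Rightarrow> ereal) \<Rightarrow> (real \<Rightarrow> real) \<Rightarrow> real \<Rightarrow> real \<Rightarrow> real" where
  "local_time p \<pi>s x t =
     (SOME l. limitin (weak_Lp p) (\<lambda>n. discrete_local_time (\<pi>s n) x t) l sequentially)"

end

theory Submission
  imports Defs
begin

text \<open>
  A nondecreasing time change carries discrete quantities of \<open>x \<circ> \<tau>\<close> along \<open>\<pi>\<close> over to discrete
  quantities of \<open>x\<close> along \<open>\<tau>\<^sub>\<pi>\<close> without any error term. Stopping commutes with \<open>\<tau>\<close>, so each summand of
  the discrete local time of \<open>x \<circ> \<tau>\<close> at \<open>t\<close> is the summand of \<open>x\<close> at \<open>\<tau> t\<close> for the points \<open>\<tau>(t\<^sub>j)\<close> and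
  \<open>\<tau>(t\<^sub>j\<^sub>+\<^sub>1)\<close>, and repeated points contribute an empty interval. The two discrete local times are
  therefore the same function (\<open>discrete_local_time_compose\<close>). Convergence at each time and the
  identity of the limits follow at once: even the representatives chosen by \<open>local_time\<close> coincide.
  Oscillations are treated similarly, with an inequality that suffices for convergence to zero
  (\<open>osc_compose_le\<close>).

  What needs an argument is the weak continuity of \<open>t \<mapsto> L (\<tau> t)\<close>, since \<open>\<tau>\<close> may jump. At a jump
  from \<open>l\<close> to \<open>\<tau> t\<close>, continuity of \<open>x \<circ> \<tau>\<close> forces \<open>x l = x (\<tau> t)\<close>, and no point of \<open>\<tau>\<^sub>\<pi>\<close> lies
  strictly between. Hence the discrete local times of \<open>x\<close> at \<open>l\<close> and at \<open>\<tau> t\<close> agree, so every test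
  functional takes the same value at \<open>L l\<close> and \<open>L (\<tau> t)\<close>: the jump of \<open>\<tau>\<close> is invisible to \<open>L\<close>
  (\<open>discrete_local_time_eq_across_gap\<close>, \<open>continuous_on_compose_cadlag\<close>).

  If \<open>\<tau>\<close> is bijective, then it is a homeomorphism of the half-line and its inverse \<open>\<rho>\<close> is an order
  isomorphism. Oscillations are then suprema of the same set, and the infima that define Lebesgue
  partitions commute with \<open>\<rho>\<close>. It remains to see that passing from a Lebesgue partition to its image
  under \<open>\<rho>\<close> discards nothing, that is, that its finite points strictly increase; this holds because
  the real points of a partition of the line are isolated and \<open>x\<close> is continuous
  (\<open>lebesgue_partition_strict\<close>).
\<close>

section \<open>Images of partitions under a time change\<close>

lemma partition_strict:
  assumes "is_partition \<pi>" "\<pi> (Suc k) < \<infinity>"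
  shows "\<pi> k < \<pi> (Suc k)"
  using assms by (auto simp: is_partition_def)

text \<open>
  Once a point is infinite, the hypothesis prevents later points from being finite again.
\<close>

lemma incseq_if_strict_below_infinity:
  fixes \<pi> :: "nat \<Rightarrow> ereal"
  assumes "\<And>k. \<pi> (Suc k) < \<infinity> \<Longrightarrow> \<pi> k < \<pi> (Suc k)"
  shows "incseq \<pi>"
proof (rule incseq_SucI)
  fix k
  show "\<pi> k \<le> \<pi> (Suc k)"
    using assms[of k] by (cases "\<pi> (Suc k) < \<infinity>") auto
qed

lemma partition_incseq: "is_partition \<pi> \<Longrightarrow> incseq \<pi>"
  by (rule incseq_if_strict_below_infinity) (rule partition_strict)

lemma partition_nonneg: "is_partition \<pi> \<Longrightarrow> 0 \<le> \<pi> k"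
  using incseqD[OF partition_incseq, of \<pi> 0 k] by (auto simp: is_partition_def)

lemma partition_first_interval:
  assumes "is_partition \<pi>"
  shows "0 \<in> {\<pi> 0..<\<pi> (Suc 0)}"
  using assms partition_strict[OF assms, of 0]
  by (cases "\<pi> (Suc 0) < \<infinity>") (auto simp: is_partition_def)

lemma partition_exceeds:
  assumes "is_partition \<pi>"
  obtains j where "ereal t \<le> \<pi> j"
proof -
  have "\<pi> \<longlonglongrightarrow> \<infinity>" using assms by (simp add: is_partition_def)
  then have "\<forall>\<^sub>F j in sequentially. ereal t < \<pi> j"
    by (rule order_tendstoD) simp
  then show thesis
    using that by (meson eventually_sequentially less_imp_le order_refl)
qed

lemma time_ext_ereal [simp]: "time_ext \<tau> (ereal r) = ereal (\<tau> r)"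
  by (simp add: time_ext_def)

lemma time_ext_PInf [simp]: "time_ext \<tau> \<infinity> = \<infinity>"
  by (simp add: time_ext_def)

lemma time_ext_mono:
  assumes "mono_on {0..} \<tau>" "0 \<le> r" "r \<le> s"
  shows "time_ext \<tau> r \<le> time_ext \<tau> s"
  using assms by (cases r; cases s) (auto simp: mono_on_def)

lemma incseq_time_ext:
  assumes "mono_on {0..} \<tau>" "is_partition \<pi>"
  shows "incseq (\<lambda>j. time_ext \<tau> (\<pi> j))"
  unfolding incseq_def
  by (auto intro!: time_ext_mono[OF assms(1) partition_nonneg[OF assms(2)]]
      incseqD[OF partition_incseq[OF assms(2)]])

lemma Inf_above_eq_next:
  fixes a :: "nat \<Rightarrow> ereal"
  assumes "incseq a" "a j < a (Suc j)"
  shows "Inf {a i | i. a j < a i} = a (Suc j)"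
proof (rule antisym)
  show "Inf {a i | i. a j < a i} \<le> a (Suc j)"
    using assms(2) by (auto intro: Inf_lower)
  show "a (Suc j) \<le> Inf {a i | i. a j < a i}"
  proof (rule Inf_greatest, clarify)
    fix i assume "a j < a i"
    then have "j < i"
      using incseqD[OF assms(1), of i j] by (meson leD not_le)
    then show "a (Suc j) \<le> a i" using incseqD[OF assms(1)] by simp
  qed
qed

text \<open>
  The index translation between \<open>\<tau>(t\<^sub>0), \<tau>(t\<^sub>1), \<dots>\<close> and the same points without repetitions: the number
  of strict increases before position \<open>j\<close> is the position of the \<open>j\<close>th point in the reduced sequence.
\<close>

primrec step_count :: "(nat \<Rightarrow> ereal) \<Rightarrow> nat \<Rightarrow> nat" where
  "step_count a 0 = 0"
| "step_count a (Suc j) = (if a j < a (Suc j) then Suc (step_count a j) else step_count a j)"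

lemma time_change_step_count:
  assumes "incseq (\<lambda>j. time_ext \<tau> (\<pi> j))"
  shows "time_change \<tau> \<pi> (step_count (\<lambda>j. time_ext \<tau> (\<pi> j)) j) = time_ext \<tau> (\<pi> j)"
proof (induction j)
  case (Suc j)
  show ?case
  proof (cases "time_ext \<tau> (\<pi> j) < time_ext \<tau> (\<pi> (Suc j))")
    case True
    then show ?thesis
      using Suc Inf_above_eq_next[OF assms True] by simp
  next
    case False
    then have "time_ext \<tau> (\<pi> j) = time_ext \<tau> (\<pi> (Suc j))"
      using incseq_SucD[OF assms, of j] by simp
    with False Suc show ?thesis by simp
  qed
qed simp

lemma incseq_time_change: "incseq (time_change \<tau> \<pi>)"
  by (rule incseq_SucI) (auto intro!: Inf_greatest)

text \<open>
  Along a nondecreasing sequence of image points the infimum over a nonempty set is attained at the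
  least index; the empty set accounts for the value \<open>\<infinity>\<close>.
\<close>

lemma time_change_in_image:
  assumes "incseq (\<lambda>j. time_ext \<tau> (\<pi> j))"
  shows "time_change \<tau> \<pi> k \<in> insert \<infinity> (range (\<lambda>j. time_ext \<tau> (\<pi> j)))"
proof (cases k)
  case (Suc k')
  define S where "S = {j. time_change \<tau> \<pi> k' < time_ext \<tau> (\<pi> j)}"
  have *: "time_change \<tau> \<pi> k = Inf ((\<lambda>j. time_ext \<tau> (\<pi> j)) ` S)"
    unfolding Suc S_def by (simp add: image_def) (meson)
  show ?thesis
  proof (cases "S = {}")
    case True
    then show ?thesis using * by (simp add: top_ereal_def)
  next
    case False
    define m where "m = (LEAST j. j \<in> S)"
    have "m \<in> S" "\<And>j. j \<in> S \<Longrightarrow> m \<le> j"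
      using False unfolding m_def by (auto intro: LeastI Least_le)
    then have "time_change \<tau> \<pi> k = time_ext \<tau> (\<pi> m)"
      unfolding * by (intro antisym Inf_lower Inf_greatest) (auto intro: incseqD[OF assms])
    then show ?thesis by simp
  qed
qed simp

section \<open>Discrete local times\<close>

text \<open>
  A nondecreasing map commutes with minima: \<open>\<tau> (min s t) = min (\<tau> s) (\<tau> t)\<close>.
\<close>

lemma stopped_compose:
  assumes "mono_on {0..} \<tau>" "0 \<le> s" "0 \<le> t"
  shows "stopped (x \<circ> \<tau>) t s = stopped x (\<tau> t) (time_ext \<tau> s)"
proof (cases s)
  case (real r)
  with assms have "min (\<tau> r) (\<tau> t) = \<tau> (min r t)"
    by (auto simp: min_def mono_on_def intro: antisym)
  with real show ?thesis by (simp add: stopped_def flip: ereal_min)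
qed (use assms in \<open>auto simp: stopped_def min_def\<close>)

lemma stopped_after: "ereal t \<le> s \<Longrightarrow> stopped x t s = x t"
  by (simp add: stopped_def min_def)

lemma between_self [simp]: "between c c = {}"
  by (simp add: between_def)

lemma discrete_local_time_eq_sum:
  assumes "incseq \<pi>" "ereal t \<le> \<pi> N"
  shows "discrete_local_time \<pi> x t u =
     2 * (\<Sum>j<N. indicator (between (stopped x t (\<pi> j)) (stopped x t (\<pi> (Suc j)))) u *
              \<bar>stopped x t (\<pi> (Suc j)) - u\<bar>)"
proof -
  have "stopped x t (\<pi> j) = x t" if "N \<le> j" for j
    using that assms incseqD[OF assms(1) that] by (intro stopped_after) simp
  then show ?thesis
    unfolding discrete_local_time_def
    by (subst suminf_finite[where N = "{..<N}"]) auto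
qed

text \<open>
  The partial sums on the two sides agree along the index translation \<open>step_count\<close>: a repeated
  point adds the interval between equal values, which is empty. Past the first point beyond \<open>t\<close> the
  stopped paths are constant, so the partial sums up to there are the full series.
\<close>

lemma discrete_local_time_compose:
  assumes "mono_on {0..} \<tau>" "is_partition \<pi>" "0 \<le> t"
  shows "discrete_local_time \<pi> (x \<circ> \<tau>) t = discrete_local_time (time_change \<tau> \<pi>) x (\<tau> t)"
proof
  fix u
  define a where "a = (\<lambda>j. time_ext \<tau> (\<pi> j))"
  define b where "b = time_change \<tau> \<pi>"
  define F where "F v w = indicator (between (stopped x (\<tau> t) v) (stopped x (\<tau> t) w)) u *
    \<bar>stopped x (\<tau> t) w - u\<bar>" for v w
  have inc: "incseq a" unfolding a_def by (rule incseq_time_ext[OF assms(1,2)])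
  have b_count: "b (step_count a j) = a j" for j
    using time_change_step_count inc by (simp add: a_def b_def)
  have F_self: "F v v = 0" for v by (simp add: F_def)
  have sums: "(\<Sum>j<n. F (a j) (a (Suc j))) = (\<Sum>k<step_count a n. F (b k) (b (Suc k)))" for n
  proof (induction n)
    case (Suc n)
    show ?case
    proof (cases "a n < a (Suc n)")
      case True
      then show ?thesis using Suc b_count[of n] b_count[of "Suc n"] by simp
    next
      case False
      then have "a (Suc n) = a n" using incseq_SucD[OF inc, of n] by simp
      with False Suc F_self show ?thesis by simp
    qed
  qed simp
  obtain N where N: "ereal t \<le> \<pi> N" using partition_exceeds[OF assms(2)] .
  then have "ereal (\<tau> t) \<le> b (step_count a N)"
    using time_ext_mono[OF assms(1) _ N] assms(3) by (simp add: b_count) (simp add: a_def)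
  then have "discrete_local_time b x (\<tau> t) u = 2 * (\<Sum>k<step_count a N. F (b k) (b (Suc k)))"
    unfolding F_def b_def by (intro discrete_local_time_eq_sum incseq_time_change)
  moreover have "discrete_local_time \<pi> (x \<circ> \<tau>) t u = 2 * (\<Sum>j<N. F (a j) (a (Suc j)))"
    by (simp add: discrete_local_time_eq_sum[OF partition_incseq[OF assms(2)] N] F_def a_def
        stopped_compose[OF assms(1) partition_nonneg[OF assms(2)] assms(3)])
  ultimately show "discrete_local_time \<pi> (x \<circ> \<tau>) t u =
      discrete_local_time (time_change \<tau> \<pi>) x (\<tau> t) u"
    by (simp add: sums b_def)
qed

text \<open>
  A partition without points inside the gap cannot tell the times \<open>l\<close> and \<open>r\<close> apart: stopping at
  either one changes a partition point only if the point is not before the gap, and then both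
  stopped values are \<open>x l = x r\<close>.
\<close>

lemma discrete_local_time_eq_across_gap:
  assumes "l \<le> r" "x l = x r" "\<And>j. \<pi> j \<le> ereal l \<or> ereal r \<le> \<pi> j"
  shows "discrete_local_time \<pi> x l = discrete_local_time \<pi> x r"
proof -
  have "stopped x l (\<pi> j) = stopped x r (\<pi> j)" for j
    using assms(3)[of j]
  proof
    assume "\<pi> j \<le> ereal l"
    moreover have "\<pi> j \<le> ereal r" using calculation assms(1) by (meson ereal_less_eq(3) order_trans)
    ultimately show ?thesis by (simp add: stopped_def min_def)
  next
    assume "ereal r \<le> \<pi> j"
    moreover have "ereal l \<le> \<pi> j" using calculation assms(1) by (meson ereal_less_eq(3) order_trans)
    ultimately show ?thesis using assms(2) by (simp add: stopped_after)
  qed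
  then show ?thesis by (simp add: discrete_local_time_def fun_eq_iff)
qed

section \<open>Oscillations\<close>

text \<open>
  Suprema of reals are only meaningful for bounded sets; here \<open>x\<close> is bounded on \<open>{0..t}\<close> by compactness.
\<close>

lemma osc_bdd_above:
  fixes x :: "real \<Rightarrow> real"
  assumes "continuous_on {0..} x"
  shows "bdd_above {\<bar>x b - x a\<bar> | a b. a \<in> {0..t} \<and> b \<in> {0..t} \<and>
            (\<exists>k. ereal a \<in> {\<pi> k..<\<pi> (Suc k)} \<and> ereal b \<in> {\<pi> k..<\<pi> (Suc k)})}"
proof -
  have "continuous_on {0..t} x" by (rule continuous_on_subset[OF assms]) auto
  then have "bounded (x ` {0..t})" by (intro compact_imp_bounded compact_continuous_image) auto
  then obtain B where B: "\<And>s. s \<in> {0..t} \<Longrightarrow> \<bar>x s\<bar> \<le> B"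
    unfolding bounded_iff by (metis imageI real_norm_def)
  have "\<bar>x b - x a\<bar> \<le> 2 * B" if "a \<in> {0..t}" "b \<in> {0..t}" for a b
    using B[OF that(1)] B[OF that(2)] by linarith
  then show ?thesis by (intro bdd_aboveI[where M = "2 * B"]) blast
qed

lemma osc_upper:
  assumes "continuous_on {0..} x" "a \<in> {0..t}" "b \<in> {0..t}"
    "ereal a \<in> {\<pi> k..<\<pi> (Suc k)}" "ereal b \<in> {\<pi> k..<\<pi> (Suc k)}"
  shows "\<bar>x b - x a\<bar> \<le> osc t x \<pi>"
  unfolding osc_def using assms by (intro cSup_upper osc_bdd_above) blast+

lemma osc_nonneg:
  assumes "continuous_on {0..} x" "is_partition \<pi>" "0 \<le> t"
  shows "0 \<le> osc t x \<pi>"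
  using osc_upper[OF assms(1), of 0 t 0 \<pi> 0] partition_first_interval[OF assms(2)] assms(3)
  by (simp add: zero_ereal_def)

text \<open>
  By symmetry of the increment it suffices to bound it for ordered pairs of times.
\<close>

lemma osc_least:
  assumes "is_partition \<pi>" "0 \<le> t"
    and "\<And>a b k. \<lbrakk>a \<in> {0..t}; b \<in> {0..t}; a \<le> b;
       ereal a \<in> {\<pi> k..<\<pi> (Suc k)}; ereal b \<in> {\<pi> k..<\<pi> (Suc k)}\<rbrakk> \<Longrightarrow> \<bar>x b - x a\<bar> \<le> C"
  shows "osc t x \<pi> \<le> C"
  unfolding osc_def
proof (rule cSup_least)
  have "0 \<in> {0..t}" "ereal 0 \<in> {\<pi> 0..<\<pi> (Suc 0)}"
    using assms(2) partition_first_interval[OF assms(1)] by (auto simp: zero_ereal_def)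
  then show "{\<bar>x b - x a\<bar> | a b. a \<in> {0..t} \<and> b \<in> {0..t} \<and>
      (\<exists>k. ereal a \<in> {\<pi> k..<\<pi> (Suc k)} \<and> ereal b \<in> {\<pi> k..<\<pi> (Suc k)})} \<noteq> {}"
    by blast
next
  fix z
  assume "z \<in> {\<bar>x b - x a\<bar> | a b. a \<in> {0..t} \<and> b \<in> {0..t} \<and>
      (\<exists>k. ereal a \<in> {\<pi> k..<\<pi> (Suc k)} \<and> ereal b \<in> {\<pi> k..<\<pi> (Suc k)})}"
  then obtain a b k where z: "z = \<bar>x b - x a\<bar>" and ab: "a \<in> {0..t}" "b \<in> {0..t}"
    "ereal a \<in> {\<pi> k..<\<pi> (Suc k)}" "ereal b \<in> {\<pi> k..<\<pi> (Suc k)}" by blast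
  show "z \<le> C"
  proof (cases "a \<le> b")
    case True
    then show ?thesis unfolding z by (intro assms(3)[where k = k] ab)
  next
    case False
    then have "\<bar>x a - x b\<bar> \<le> C" by (intro assms(3)[where k = k] ab) simp
    then show ?thesis unfolding z by (simp add: abs_minus_commute)
  qed
qed

text \<open>
  \<open>\<tau>\<close> maps an interval \<open>[t\<^sub>k, t\<^sub>k\<^sub>+\<^sub>1)\<close> into the closure of an interval of the image partition, and
  passing to the closure does not increase the oscillation of a continuous path. Equality can fail, as
  \<open>\<tau>\<close> may skip values.
\<close>

lemma osc_compose_le:
  assumes x: "continuous_on {0..} x" and \<tau>: "mono_on {0..} \<tau>" "\<tau> 0 = 0"
    and part: "is_partition \<pi>" "is_partition (time_change \<tau> \<pi>)" and t: "0 \<le> t"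
  shows "osc t (x \<circ> \<tau>) \<pi> \<le> osc (\<tau> t) x (time_change \<tau> \<pi>)"
proof (rule osc_least[OF part(1) t])
  fix \<alpha> \<beta> k
  assume \<alpha>\<beta>: "\<alpha> \<in> {0..t}" "\<beta> \<in> {0..t}" "\<alpha> \<le> \<beta>"
    and \<alpha>: "ereal \<alpha> \<in> {\<pi> k..<\<pi> (Suc k)}" and \<beta>: "ereal \<beta> \<in> {\<pi> k..<\<pi> (Suc k)}"
  let ?a = "\<lambda>j. time_ext \<tau> (\<pi> j)" and ?\<sigma> = "time_change \<tau> \<pi>"
  have ord: "0 \<le> \<tau> \<alpha>" "\<tau> \<alpha> \<le> \<tau> \<beta>" "\<tau> \<beta> \<le> \<tau> t"
    using \<alpha>\<beta> mono_onD[OF \<tau>(1), of 0 \<alpha>] \<tau>(2) by (auto intro: mono_onD[OF \<tau>(1)])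
  show "\<bar>(x \<circ> \<tau>) \<beta> - (x \<circ> \<tau>) \<alpha>\<bar> \<le> osc (\<tau> t) x ?\<sigma>"
  proof (cases "\<tau> \<alpha> = \<tau> \<beta>")
    case True
    then show ?thesis using osc_nonneg[OF x part(2), of "\<tau> t"] ord by simp
  next
    case False
    then have less: "\<tau> \<alpha> < \<tau> \<beta>" using ord by simp
    have lo: "?a k \<le> ereal (\<tau> \<alpha>)"
      using time_ext_mono[OF \<tau>(1) partition_nonneg[OF part(1)], of k "ereal \<alpha>"] \<alpha> by simp
    have hi: "ereal (\<tau> \<beta>) \<le> ?a (Suc k)"
      using time_ext_mono[OF \<tau>(1), of "ereal \<beta>" "\<pi> (Suc k)"] \<alpha>\<beta> \<beta>
      by (simp add: less_imp_le)
    have "?a k < ?a (Suc k)"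
      using lo hi less by (meson ereal_less(2) le_less_trans less_le_trans less_ereal.simps(1))
    moreover have inc: "incseq ?a" by (rule incseq_time_ext[OF \<tau>(1) part(1)])
    ultimately obtain m where m: "?\<sigma> m = ?a k" "?\<sigma> (Suc m) = ?a (Suc k)"
      using time_change_step_count[OF inc, of k] time_change_step_count[OF inc, of "Suc k"]
      by (metis step_count.simps(2))
    \<comment> \<open>\<open>\<tau> \<beta>\<close> may be the right endpoint of its interval, which is excluded from the oscillation;
      it is reached by continuity of \<open>x\<close>.\<close>
    have bound: "\<bar>x s - x (\<tau> \<alpha>)\<bar> \<le> osc (\<tau> t) x ?\<sigma>" if "s \<in> {\<tau> \<alpha><..<\<tau> \<beta>}" for s
    proof (rule osc_upper[OF x, where k = m])
      have "ereal s < ereal (\<tau> \<beta>)" "ereal (\<tau> \<alpha>) < ereal (\<tau> \<beta>)" "ereal (\<tau> \<alpha>) < ereal s"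
        using that less by auto
      then show "ereal (\<tau> \<alpha>) \<in> {?\<sigma> m..<?\<sigma> (Suc m)}" "ereal s \<in> {?\<sigma> m..<?\<sigma> (Suc m)}"
        unfolding m atLeastLessThan_iff using lo hi by (meson less_le_trans order_trans less_imp_le)+
    qed (use that ord in auto)
    have "(x \<longlongrightarrow> x (\<tau> \<beta>)) (at (\<tau> \<beta>) within {0..})"
      using x ord by (auto simp: continuous_on_def)
    then have "(x \<longlongrightarrow> x (\<tau> \<beta>)) (at (\<tau> \<beta>) within {\<tau> \<alpha>..\<tau> \<beta>})"
      by (rule tendsto_within_subset) (use ord in auto)
    then have "((\<lambda>s. \<bar>x s - x (\<tau> \<alpha>)\<bar>) \<longlongrightarrow> \<bar>x (\<tau> \<beta>) - x (\<tau> \<alpha>)\<bar>) (at_left (\<tau> \<beta>))"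
      unfolding at_within_Icc_at_left[OF less, symmetric] by (intro tendsto_intros)
    moreover have "\<forall>\<^sub>F s in at_left (\<tau> \<beta>). \<bar>x s - x (\<tau> \<alpha>)\<bar> \<le> osc (\<tau> t) x ?\<sigma>"
      using eventually_at_left_real[OF less] by eventually_elim (rule bound)
    ultimately show ?thesis
      using tendsto_upperbound by fastforce
  qed
qed

section \<open>The weak topology and time changes with jumps\<close>

lemma weak_Lp_subbasic_open:
  assumes "\<phi> \<in> test_functionals p" "open U"
  shows "openin (weak_Lp p) {f \<in> Lp p. \<phi> f \<in> U}"
  unfolding weak_Lp_def using assms by (intro topology_generated_by_Basis) blast

lemma topspace_weak_Lp_subset: "topspace (weak_Lp p) \<subseteq> Lp p"
  unfolding weak_Lp_def by (auto simp: topology_generated_by_topspace)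

lemma limitin_weak_Lp_functional:
  assumes "limitin (weak_Lp p) f l F" "\<phi> \<in> test_functionals p"
  shows "((\<lambda>n. \<phi> (f n)) \<longlongrightarrow> \<phi> l) F"
proof (rule topological_tendstoI)
  fix U assume U: "open U" "\<phi> l \<in> U"
  have "l \<in> Lp p" using assms(1) topspace_weak_Lp_subset by (auto simp: limitin_def)
  then have "\<forall>\<^sub>F n in F. f n \<in> {f \<in> Lp p. \<phi> f \<in> U}"
    using assms U weak_Lp_subbasic_open[OF assms(2) U(1)] by (auto simp: limitin_def)
  then show "\<forall>\<^sub>F n in F. \<phi> (f n) \<in> U" by eventually_elim simp
qed

lemma continuous_map_weak_Lp_functional:
  assumes "continuous_map (top_of_set S) (weak_Lp p) L" "\<phi> \<in> test_functionals p"
  shows "continuous_on S (\<lambda>s. \<phi> (L s))"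
proof -
  have L: "L s \<in> Lp p" if "s \<in> S" for s
    using assms(1) that topspace_weak_Lp_subset by (auto simp: continuous_map_def Pi_iff)
  have "openin (top_of_set S) (S \<inter> (\<lambda>s. \<phi> (L s)) -` U)" if "open U" for U
  proof -
    have "openin (top_of_set S) {s \<in> topspace (top_of_set S). L s \<in> {f \<in> Lp p. \<phi> f \<in> U}}"
      by (rule openin_continuous_map_preimage[OF assms(1) weak_Lp_subbasic_open[OF assms(2) that]])
    moreover have "{s \<in> topspace (top_of_set S). L s \<in> {f \<in> Lp p. \<phi> f \<in> U}} =
        S \<inter> (\<lambda>s. \<phi> (L s)) -` U" using L by auto
    ultimately show ?thesis by simp
  qed
  then show ?thesis by (simp add: continuous_on_open_gen[where T = UNIV] openin_subtopology)
qed

text \<open>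
  Together with \<open>continuous_map_weak_Lp_functional\<close> this characterizes weak continuity by the real
  functions \<open>s \<mapsto> \<phi> (L s)\<close>, which reduces continuity of a time-changed local time to real analysis.
\<close>

lemma continuous_map_weak_LpI:
  assumes "\<And>s. s \<in> S \<Longrightarrow> L s \<in> topspace (weak_Lp p)"
    and "\<And>\<phi>. \<phi> \<in> test_functionals p \<Longrightarrow> continuous_on S (\<lambda>s. \<phi> (L s))"
  shows "continuous_map (top_of_set S) (weak_Lp p) L"
  unfolding weak_Lp_def
proof (rule continuous_on_generated_topo)
  show "L ` topspace (top_of_set S) \<subseteq>
      \<Union> {{f \<in> Lp p. \<phi> f \<in> U} |\<phi> U. \<phi> \<in> test_functionals p \<and> open U}"
    using assms(1) unfolding weak_Lp_def by (auto simp: topology_generated_by_topspace)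
next
  fix V assume "V \<in> {{f \<in> Lp p. \<phi> f \<in> U} |\<phi> U. \<phi> \<in> test_functionals p \<and> open U}"
  then obtain \<phi> U where V: "V = {f \<in> Lp p. \<phi> f \<in> U}" "\<phi> \<in> test_functionals p" "open U" by blast
  have "L -` V \<inter> topspace (top_of_set S) = S \<inter> (\<lambda>s. \<phi> (L s)) -` U"
    using assms(1) topspace_weak_Lp_subset V(1) by auto
  then show "openin (top_of_set S) (L -` V \<inter> topspace (top_of_set S))"
    using continuous_openin_preimage_gen[OF assms(2)[OF V(2)] V(3)] by simp
qed

lemma cadlag_left_limit:
  assumes "mono_on {0..} \<tau>" "cadlag \<tau>" "0 < t"
  obtains l where "(\<tau> \<longlongrightarrow> l) (at_left t)" "\<And>s. \<lbrakk>0 \<le> s; s < t\<rbrakk> \<Longrightarrow> \<tau> s \<le> l" "l \<le> \<tau> t"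
proof -
  obtain l where l: "(\<tau> \<longlongrightarrow> l) (at_left t)"
    using assms(2,3) by (auto simp: cadlag_def)
  have "\<tau> s \<le> l" if "0 \<le> s" "s < t" for s
    using eventually_at_left_real[OF that(2)] that(1)
    by (intro tendsto_lowerbound[OF l]) (auto elim!: eventually_mono intro: mono_onD[OF assms(1)])
  moreover have "l \<le> \<tau> t"
    using eventually_at_left_real[OF assms(3)] assms(3)
    by (intro tendsto_upperbound[OF l]) (auto elim!: eventually_mono intro: mono_onD[OF assms(1)])
  ultimately show thesis using that l by blast
qed

text \<open>
  \<open>\<tau>\<close> is right-continuous and has left limits, so \<open>g \<circ> \<tau>\<close> inherits both properties, and the only
  obstruction to continuity is a left limit \<open>g l\<close> of \<open>g \<circ> \<tau>\<close> that differs from \<open>g (\<tau> t)\<close>.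
\<close>

lemma continuous_on_compose_cadlag:
  fixes g :: "real \<Rightarrow> real"
  assumes g: "continuous_on {0..} g"
    and \<tau>: "mono_on {0..} \<tau>" "cadlag \<tau>" "\<tau> 0 = 0"
    and gap: "\<And>t l. \<lbrakk>0 < t; (\<tau> \<longlongrightarrow> l) (at_left t); \<And>s. \<lbrakk>0 \<le> s; s < t\<rbrakk> \<Longrightarrow> \<tau> s \<le> l; l \<le> \<tau> t\<rbrakk>
      \<Longrightarrow> g l = g (\<tau> t)"
  shows "continuous_on {0..} (\<lambda>t. g (\<tau> t))"
proof -
  have nonneg: "0 \<le> \<tau> t" if "0 \<le> t" for t
    using mono_onD[OF \<tau>(1), of 0 t] \<tau>(3) that by simp
  have comp: "((\<lambda>s. g (\<tau> s)) \<longlongrightarrow> g l) F"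
    if "(\<tau> \<longlongrightarrow> l) F" "0 \<le> l" "\<forall>\<^sub>F s in F. 0 \<le> \<tau> s" for l F
    using continuous_on_tendsto_compose[OF g that(1)] that(2,3) by simp
  have right: "((\<lambda>s. g (\<tau> s)) \<longlongrightarrow> g (\<tau> t)) (at_right t)" if "0 \<le> t" for t
  proof (rule comp)
    show "(\<tau> \<longlongrightarrow> \<tau> t) (at_right t)" using \<tau>(2) that by (auto simp: cadlag_def continuous_within)
    show "\<forall>\<^sub>F s in at_right t. 0 \<le> \<tau> s"
      using eventually_at_right_less[of t] by eventually_elim (use that nonneg in auto)
  qed (use nonneg that in auto)
  have left: "((\<lambda>s. g (\<tau> s)) \<longlongrightarrow> g (\<tau> t)) (at_left t)" if t: "0 < t" for t
  proof -
    obtain l where l: "(\<tau> \<longlongrightarrow> l) (at_left t)" "\<And>s. \<lbrakk>0 \<le> s; s < t\<rbrakk> \<Longrightarrow> \<tau> s \<le> l" "l \<le> \<tau> t"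
      using cadlag_left_limit[OF \<tau>(1,2) t] by blast
    have "((\<lambda>s. g (\<tau> s)) \<longlongrightarrow> g l) (at_left t)"
    proof (rule comp[OF l(1)])
      show "0 \<le> l" using l(2)[of 0] t \<tau>(3) by simp
      show "\<forall>\<^sub>F s in at_left t. 0 \<le> \<tau> s"
        using eventually_at_left_real[OF t] by eventually_elim (use nonneg in auto)
    qed
    then show ?thesis using gap[OF t l] by simp
  qed
  show ?thesis
    unfolding continuous_on_def
  proof
    fix t :: real assume "t \<in> {0..}"
    then consider "t = 0" | "0 < t" by fastforce
    then show "((\<lambda>s. g (\<tau> s)) \<longlongrightarrow> g (\<tau> t)) (at t within {0..})"
    proof cases
      case 1
      then show ?thesis using right[of 0] by (simp add: at_within_Ici_at_right)
    next
      case 2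
      then have "((\<lambda>s. g (\<tau> s)) \<longlongrightarrow> g (\<tau> t)) (at t)"
        using left right by (simp add: filterlim_at_split)
      then show ?thesis by (rule tendsto_within_subset[OF _ subset_UNIV])
    qed
  qed
qed

text \<open>
  If \<open>L\<close> is the local time of \<open>x\<close>, then \<open>t \<mapsto> L (\<tau> t)\<close> is that of \<open>x \<circ> \<tau>\<close>. The jumps of \<open>\<tau>\<close> do no harm,
  because the weak limits at both ends of a jump are limits of the same sequence.
\<close>

lemma local_time_paths_compose:
  assumes \<tau>: "mono_on {0..} \<tau>" "cadlag \<tau>" "\<tau> 0 = 0"
    and part: "\<And>n. is_partition (\<pi>s n)"
    and y: "continuous_on {0..} (x \<circ> \<tau>)"
    and osc: "\<And>t. 0 \<le> t \<Longrightarrow> (\<lambda>n. osc t (x \<circ> \<tau>) (\<pi>s n)) \<longlonglongrightarrow> 0"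
    and x: "x \<in> local_time_paths p (\<lambda>n. time_change \<tau> (\<pi>s n))"
  shows "x \<circ> \<tau> \<in> local_time_paths p \<pi>s"
proof -
  let ?D = "\<lambda>n. discrete_local_time (time_change \<tau> (\<pi>s n)) x"
  obtain L where lim: "\<And>t. 0 \<le> t \<Longrightarrow> limitin (weak_Lp p) (\<lambda>n. ?D n t) (L t) sequentially"
    and L: "continuous_map (top_of_set {0..}) (weak_Lp p) L" and cx: "continuous_on {0..} x"
    using x by (auto simp: local_time_paths_def)
  have nonneg: "0 \<le> \<tau> t" if "0 \<le> t" for t
    using mono_onD[OF \<tau>(1), of 0 t] \<tau>(3) that by simp
  have "limitin (weak_Lp p) (\<lambda>n. discrete_local_time (\<pi>s n) (x \<circ> \<tau>) t) (L (\<tau> t)) sequentially"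
    if "0 \<le> t" for t
    using lim[OF nonneg[OF that]] by (simp add: discrete_local_time_compose[OF \<tau>(1) part that])
  moreover have "continuous_map (top_of_set {0..}) (weak_Lp p) (\<lambda>t. L (\<tau> t))"
  proof (rule continuous_map_weak_LpI)
    fix t :: real assume "t \<in> {0..}"
    then show "L (\<tau> t) \<in> topspace (weak_Lp p)"
      using L nonneg by (auto simp: continuous_map_def Pi_iff)
  next
    fix \<phi> assume \<phi>: "\<phi> \<in> test_functionals p"
    show "continuous_on {0..} (\<lambda>t. \<phi> (L (\<tau> t)))"
    proof (rule continuous_on_compose_cadlag[OF continuous_map_weak_Lp_functional[OF L \<phi>] \<tau>])
      fix t l
      assume t: "0 < t" and l: "(\<tau> \<longlongrightarrow> l) (at_left t)"
        and below: "\<And>s. \<lbrakk>0 \<le> s; s < t\<rbrakk> \<Longrightarrow> \<tau> s \<le> l" and above: "l \<le> \<tau> t"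
      have l0: "0 \<le> l" using below[of 0] t \<tau>(3) by simp
      have "x l = x (\<tau> t)"
      proof (rule tendsto_unique)
        show "((\<lambda>s. x (\<tau> s)) \<longlongrightarrow> x l) (at_left t)"
        proof (rule continuous_on_tendsto_compose[OF cx l])
          show "\<forall>\<^sub>F s in at_left t. \<tau> s \<in> {0..}"
            using eventually_at_left_real[OF t] by eventually_elim (use nonneg in auto)
        qed (use l0 in simp)
        have "((x \<circ> \<tau>) \<longlongrightarrow> (x \<circ> \<tau>) t) (at t within {0..})"
          using y t unfolding continuous_on_def by (metis atLeast_iff less_imp_le)
        then have "((x \<circ> \<tau>) \<longlongrightarrow> (x \<circ> \<tau>) t) (at t within {0..t})"
          by (rule tendsto_within_subset) auto
        then show "((\<lambda>s. x (\<tau> s)) \<longlongrightarrow> x (\<tau> t)) (at_left t)"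
          unfolding at_within_Icc_at_left[OF t] by (simp add: o_def)
      qed simp
      moreover have "time_change \<tau> (\<pi>s n) j \<le> ereal l \<or> ereal (\<tau> t) \<le> time_change \<tau> (\<pi>s n) j" for n j
      proof -
        have no_gap: "time_ext \<tau> (\<pi>s n i) \<le> ereal l \<or> ereal (\<tau> t) \<le> time_ext \<tau> (\<pi>s n i)" for i
          using partition_nonneg[OF part, of n i] below t
          by (cases "\<pi>s n i"; cases "\<pi>s n i < ereal t")
             (auto intro: mono_onD[OF \<tau>(1)])
        consider "time_change \<tau> (\<pi>s n) j = \<infinity>"
          | i where "time_change \<tau> (\<pi>s n) j = time_ext \<tau> (\<pi>s n i)"
          using time_change_in_image[OF incseq_time_ext[OF \<tau>(1) part[of n]], of j] by blast
        then show ?thesis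
        proof cases
          case (2 i)
          then show ?thesis using no_gap[of i] by (simp only:)
        qed simp
      qed
      ultimately have "?D n l = ?D n (\<tau> t)" for n
        by (intro discrete_local_time_eq_across_gap above)
      then have "(\<lambda>n. \<phi> (?D n (\<tau> t))) \<longlonglongrightarrow> \<phi> (L l)"
        using limitin_weak_Lp_functional[OF lim[OF l0] \<phi>] by simp
      then show "\<phi> (L l) = \<phi> (L (\<tau> t))"
        using limitin_weak_Lp_functional[OF lim[of "\<tau> t"] \<phi>] nonneg t
        by (intro LIMSEQ_unique) auto
    qed
  qed
  ultimately have "\<exists>L. (\<forall>t\<ge>0. limitin (weak_Lp p)
        (\<lambda>n. discrete_local_time (\<pi>s n) (x \<circ> \<tau>) t) (L t) sequentially) \<and>
      continuous_map (top_of_set {0..}) (weak_Lp p) L"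
    by (intro exI[of _ "\<lambda>t. L (\<tau> t)"]) simp
  then show ?thesis
    using y osc unfolding local_time_paths_def by blast
qed

section \<open>Bijective time changes\<close>

lemma strict_mono_on_inv_into:
  fixes \<tau> :: "real \<Rightarrow> real"
  assumes "mono_on {0..} \<tau>" "bij_betw \<tau> {0..} {0..}"
  shows "strict_mono_on {0..} (inv_into {0..} \<tau>)"
proof (rule strict_mono_onI)
  fix r s :: real assume rs: "r \<in> {0..}" "s \<in> {0..}" "r < s"
  show "inv_into {0..} \<tau> r < inv_into {0..} \<tau> s"
  proof (rule ccontr)
    assume "\<not> ?thesis"
    then have "\<tau> (inv_into {0..} \<tau> s) \<le> \<tau> (inv_into {0..} \<tau> r)"
      using rs bij_betwE[OF bij_betw_inv_into[OF assms(2)]] by (intro mono_onD[OF assms(1)]) auto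
    then show False
      using rs by (simp add: bij_betw_inv_into_right[OF assms(2)])
  qed
qed

text \<open>
  A monotone function with open range is continuous. The range \<open>{0..}\<close> is not open in the real line,
  so \<open>\<tau>\<close> is first extended by the identity to a monotone surjection of the whole line.
\<close>

lemma mono_bij_continuous:
  fixes \<tau> :: "real \<Rightarrow> real"
  assumes \<tau>: "mono_on {0..} \<tau>" "bij_betw \<tau> {0..} {0..}"
  shows "continuous_on {0..} \<tau>"
proof -
  define f where "f t = (if t < 0 then t else \<tau> t)" for t
  have img: "\<tau> ` {0..} = {0..}" using \<tau>(2) by (simp add: bij_betw_def)
  have "range f = UNIV"
  proof -
    have "s \<in> range f" for s
    proof (cases "s < 0")
      case True
      then have "f s = s" by (simp add: f_def)
      then show ?thesis by (metis rangeI)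
    next
      case False
      then obtain t where "0 \<le> t" "\<tau> t = s" using img by (metis atLeast_iff imageE not_less)
      then have "f t = s" by (simp add: f_def)
      then show ?thesis by blast
    qed
    then show ?thesis by blast
  qed
  moreover have "f r \<le> f s" if "r \<le> s" for r s
  proof -
    have "0 \<le> \<tau> s" if "0 \<le> s" using img that by auto
    then show ?thesis using \<open>r \<le> s\<close> mono_onD[OF \<tau>(1), of r s] by (auto simp: f_def)
  qed
  ultimately have "continuous_on UNIV f" by (intro continuous_onI_mono) auto
  then have "continuous_on {0..} f" by (rule continuous_on_subset) simp
  then show ?thesis by (simp add: f_def cong: continuous_on_cong_simp)
qed

lemma time_ext_strict_mono:
  assumes "strict_mono_on {0..} \<rho>" "0 \<le> r" "r < s"
  shows "time_ext \<rho> r < time_ext \<rho> s"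
  using assms by (cases r; cases s) (auto simp: strict_mono_on_def)

text \<open>
  Under a strictly increasing time change no points of a partition coincide, so nothing is discarded.
  This applies to partitions of the time axis and to Lebesgue partitions alike.
\<close>

lemma time_change_strict_mono:
  assumes "strict_mono_on {0..} \<rho>" "\<pi> 0 = 0"
    and strict: "\<And>k. \<pi> (Suc k) < \<infinity> \<Longrightarrow> \<pi> k < \<pi> (Suc k)"
  shows "time_change \<rho> \<pi> k = time_ext \<rho> (\<pi> k)"
proof (induction k)
  case (Suc k)
  let ?a = "\<lambda>j. time_ext \<rho> (\<pi> j)"
  have inc: "incseq \<pi>" by (rule incseq_if_strict_below_infinity) (rule strict)
  have nonneg: "0 \<le> \<pi> j" for j using incseqD[OF inc, of 0 j] assms(2) by simp
  have inc_a: "incseq ?a"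
    unfolding incseq_def
    by (auto intro!: time_ext_mono strict_mono_on_imp_mono_on assms(1) nonneg incseqD[OF inc])
  show ?case
  proof (cases "\<pi> k < \<pi> (Suc k)")
    case True
    show ?thesis
      using Inf_above_eq_next[OF inc_a time_ext_strict_mono[OF assms(1) nonneg True]] Suc by simp
  next
    case False
    then have "\<pi> k = \<infinity>" "\<pi> (Suc k) = \<infinity>"
      using strict[of k] incseq_SucD[OF inc, of k] by auto
    then show ?thesis using Suc by (simp add: top_ereal_def)
  qed
qed simp

text \<open>
  Since \<open>P\<close> tends to \<open>\<plusminus>\<infinity>\<close>, only finitely many of its points lie near \<open>c\<close>. The point \<open>c\<close> itself may
  or may not belong to \<open>P\<close>.
\<close>

lemma real_partition_isolated:
  assumes "is_real_partition P"
  obtains e where "0 < e" "\<And>v. \<lbrakk>ereal v \<in> range P; \<bar>v - c\<bar> < e\<rbrakk> \<Longrightarrow> v = c"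
proof -
  have "\<forall>\<^sub>F k in at_top. ereal (c + 1) < P k" "\<forall>\<^sub>F k in at_bot. P k < ereal (c - 1)"
    using assms by (auto simp: is_real_partition_def intro: order_tendstoD)
  then obtain M N where MN: "\<And>k. N \<le> k \<Longrightarrow> ereal (c + 1) < P k" "\<And>k. k \<le> M \<Longrightarrow> P k < ereal (c - 1)"
    by (auto simp: eventually_at_top_linorder eventually_at_bot_linorder)
  define V where "V = (\<lambda>k. real_of_ereal (P k)) ` {M..N} - {c}"
  have "finite V" by (simp add: V_def)
  then have "open (- V)" by (simp add: finite_imp_closed open_Compl)
  moreover have "c \<in> - V" by (simp add: V_def)
  ultimately obtain d where d: "0 < d" "ball c d \<subseteq> - V" by (meson openE)
  show thesis
  proof
    \<comment> \<open>\<open>d\<close> separates \<open>c\<close> from all other points with index in \<open>{M..N}\<close>; outside that range the distance exceeds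
      \<open>1\<close>.\<close>
    show "0 < min d 1" using d by simp
    fix v assume v: "ereal v \<in> range P" "\<bar>v - c\<bar> < min d 1"
    then obtain k where k: "P k = ereal v" by (metis rangeE)
    have "k \<in> {M..N}"
      using MN(1)[of k] MN(2)[of k] v(2) k by (force simp: not_le)
    then have "v \<in> (\<lambda>k. real_of_ereal (P k)) ` {M..N}" using k by force
    moreover have "v \<notin> V" using d v(2) by (auto simp: dist_real_def subset_eq abs_minus_commute)
    ultimately show "v = c" by (simp add: V_def)
  qed
qed

lemma lebesgue_partition_nonneg: "0 \<le> lebesgue_partition P x k"
proof (induction k)
  case (Suc k)
  show ?case
    unfolding lebesgue_partition.simps
  proof (rule Inf_greatest)
    fix z
    assume "z \<in> {ereal t | t. lebesgue_partition P x k < ereal t \<and> ereal (x t) \<in> range P \<and>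
      x t \<noteq> x (real_of_ereal (lebesgue_partition P x k))}"
    then have "lebesgue_partition P x k < z" by blast
    with Suc show "0 \<le> z" by (rule order_trans[OF _ less_imp_le])
  qed
qed simp

text \<open>
  By continuity \<open>x\<close> stays for some time so close to its value at the current point that it meets no
  other level of \<open>P\<close>, so the infimum of the later hitting times is strictly larger.
\<close>

lemma lebesgue_partition_strict:
  assumes P: "is_real_partition P" and x: "continuous_on {0..} x"
    and fin: "lebesgue_partition P x (Suc k) < \<infinity>"
  shows "lebesgue_partition P x k < lebesgue_partition P x (Suc k)"
proof -
  let ?S = "{ereal t | t. lebesgue_partition P x k < ereal t \<and> ereal (x t) \<in> range P \<and>
              x t \<noteq> x (real_of_ereal (lebesgue_partition P x k))}"
  have "lebesgue_partition P x k \<noteq> \<infinity>"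
    using fin by (auto simp: top_ereal_def)
  then obtain r where r: "lebesgue_partition P x k = ereal r" "0 \<le> r"
    using lebesgue_partition_nonneg[of P x k] by (cases "lebesgue_partition P x k") auto
  obtain e where e: "0 < e" "\<And>v. \<lbrakk>ereal v \<in> range P; \<bar>v - x r\<bar> < e\<rbrakk> \<Longrightarrow> v = x r"
    using real_partition_isolated[OF P, of "x r"] by blast
  obtain d where d: "0 < d" "\<And>t. \<lbrakk>0 \<le> t; \<bar>t - r\<bar> < d\<rbrakk> \<Longrightarrow> \<bar>x t - x r\<bar> < e"
    using x r(2) e(1) unfolding continuous_on_iff dist_real_def by (metis atLeast_iff)
  have "ereal (r + d) \<le> Inf ?S"
  proof (rule Inf_greatest)
    fix z assume "z \<in> ?S"
    then obtain t where z: "z = ereal t" and t: "lebesgue_partition P x k < ereal t" "ereal (x t) \<in> range P"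
      "x t \<noteq> x (real_of_ereal (lebesgue_partition P x k))" by blast
    then have "\<not> \<bar>x t - x r\<bar> < e" using e(2)[of "x t"] r by auto
    then have "\<not> \<bar>t - r\<bar> < d" using d(2)[of t] t(1) r by auto
    then show "ereal (r + d) \<le> z" using t(1) r z by simp
  qed
  moreover have "ereal r < ereal (r + d)" using d by simp
  ultimately have "ereal r < Inf ?S" by (rule less_le_trans[rotated])
  then show ?thesis unfolding lebesgue_partition.simps using r(1) by simp
qed

context
  fixes \<tau> \<rho> :: "real \<Rightarrow> real"
  assumes \<tau>: "mono_on {0..} \<tau>" "\<tau> 0 = 0" "bij_betw \<tau> {0..} {0..}"
  defines "\<rho> \<equiv> inv_into {0..} \<tau>"
begin

lemma bij_nonneg: "0 \<le> t \<Longrightarrow> 0 \<le> \<tau> t"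
  using bij_betwE[OF \<tau>(3)] by simp

lemma inverse_nonneg: "0 \<le> t \<Longrightarrow> 0 \<le> \<rho> t"
  using bij_betwE[OF bij_betw_inv_into[OF \<tau>(3)]] by (simp add: \<rho>_def)

lemma cancel_inverse: "0 \<le> t \<Longrightarrow> \<tau> (\<rho> t) = t"
  by (simp add: \<rho>_def bij_betw_inv_into_right[OF \<tau>(3)])

lemma inverse_cancel: "0 \<le> t \<Longrightarrow> \<rho> (\<tau> t) = t"
  by (simp add: \<rho>_def bij_betw_inv_into_left[OF \<tau>(3)])

lemma inverse_strict_mono: "strict_mono_on {0..} \<rho>"
  unfolding \<rho>_def by (rule strict_mono_on_inv_into[OF \<tau>(1,3)])

lemma inverse_zero: "\<rho> 0 = 0"
  using inverse_cancel[of 0] \<tau>(2) by simp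

lemma inverse_mono: "mono_on {0..} \<rho>"
  by (rule strict_mono_on_imp_mono_on[OF inverse_strict_mono])

lemma time_ext_cancel_inverse: "0 \<le> s \<Longrightarrow> time_ext \<tau> (time_ext \<rho> s) = s"
  by (cases s) (auto simp: cancel_inverse)

lemma time_ext_inverse_cancel: "0 \<le> s \<Longrightarrow> time_ext \<rho> (time_ext \<tau> s) = s"
  by (cases s) (auto simp: inverse_cancel)

lemma time_ext_inverse_nonneg: "0 \<le> s \<Longrightarrow> 0 \<le> time_ext \<rho> s"
  by (cases s) (auto simp: inverse_nonneg)

lemma time_ext_inverse_le_iff:
  assumes "0 \<le> r" "0 \<le> s"
  shows "time_ext \<rho> r \<le> time_ext \<rho> s \<longleftrightarrow> r \<le> s"
  using time_ext_mono[OF inverse_mono assms(1)] time_ext_strict_mono[OF inverse_strict_mono assms(2)]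
  by (meson not_le)

lemma time_ext_inverse_less_iff:
  assumes "0 \<le> r" "0 \<le> s"
  shows "time_ext \<rho> r < time_ext \<rho> s \<longleftrightarrow> r < s"
  using time_ext_inverse_le_iff[OF assms(2,1)] by (meson not_le)

text \<open>
  An order isomorphism of \<open>[0, \<infinity>]\<close> preserves infima, including the empty one: \<open>Inf {} = \<infinity>\<close> is fixed.
\<close>

lemma time_ext_inverse_Inf:
  assumes "\<And>s. s \<in> A \<Longrightarrow> 0 \<le> s"
  shows "time_ext \<rho> (Inf A) = Inf (time_ext \<rho> ` A)"
proof (rule antisym)
  have A0: "0 \<le> Inf A" using assms by (auto intro: Inf_greatest)
  show "time_ext \<rho> (Inf A) \<le> Inf (time_ext \<rho> ` A)"
    by (rule Inf_greatest) (auto intro!: time_ext_mono[OF inverse_mono A0] Inf_lower)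
  define z where "z = Inf (time_ext \<rho> ` A)"
  have z0: "0 \<le> z"
    unfolding z_def using assms by (auto intro!: Inf_greatest time_ext_inverse_nonneg)
  have "time_ext \<tau> z \<le> a" if "a \<in> A" for a
    using time_ext_mono[OF \<tau>(1) z0, of "time_ext \<rho> a"] that assms[OF that]
    by (simp add: time_ext_cancel_inverse z_def INF_lower)
  then have "time_ext \<tau> z \<le> Inf A" by (rule Inf_greatest)
  moreover have "0 \<le> time_ext \<tau> z" using z0 by (cases z) (auto simp: bij_nonneg)
  ultimately have "time_ext \<rho> (time_ext \<tau> z) \<le> time_ext \<rho> (Inf A)"
    by (intro time_ext_mono[OF inverse_mono])
  then show "Inf (time_ext \<rho> ` A) \<le> time_ext \<rho> (Inf A)"
    using z0 by (simp add: time_ext_inverse_cancel z_def)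
qed

lemma osc_time_change_inverse:
  assumes "is_partition \<pi>" "0 \<le> t"
  shows "osc (\<rho> t) (x \<circ> \<tau>) (time_change \<rho> \<pi>) = osc t x \<pi>"
proof -
  have tc: "time_change \<rho> \<pi> k = time_ext \<rho> (\<pi> k)" for k
    using assms(1) by (intro time_change_strict_mono[OF inverse_strict_mono])
      (auto simp: is_partition_def)
  have mem: "ereal (\<rho> a) \<in> {time_ext \<rho> (\<pi> k)..<time_ext \<rho> (\<pi> (Suc k))} \<longleftrightarrow>
      ereal a \<in> {\<pi> k..<\<pi> (Suc k)}" if "0 \<le> a" for a k
    using time_ext_inverse_le_iff[OF partition_nonneg[OF assms(1)], of "ereal a" k]
      time_ext_inverse_less_iff[OF _ partition_nonneg[OF assms(1)], of "ereal a" "Suc k"] that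
    by simp
  have le: "\<rho> a \<in> {0..\<rho> t} \<longleftrightarrow> a \<in> {0..t}" if "0 \<le> a" for a
    using time_ext_inverse_le_iff[of "ereal a" "ereal t"] that assms(2) inverse_nonneg by simp
  have "{\<bar>(x \<circ> \<tau>) b - (x \<circ> \<tau>) a\<bar> | a b. a \<in> {0..\<rho> t} \<and> b \<in> {0..\<rho> t} \<and>
          (\<exists>k. ereal a \<in> {time_ext \<rho> (\<pi> k)..<time_ext \<rho> (\<pi> (Suc k))} \<and>
               ereal b \<in> {time_ext \<rho> (\<pi> k)..<time_ext \<rho> (\<pi> (Suc k))})} =
      {\<bar>x b - x a\<bar> | a b. a \<in> {0..t} \<and> b \<in> {0..t} \<and>
          (\<exists>k. ereal a \<in> {\<pi> k..<\<pi> (Suc k)} \<and> ereal b \<in> {\<pi> k..<\<pi> (Suc k)})}" (is "?A = ?B")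
  proof (intro equalityI subsetI)
    fix z assume "z \<in> ?A"
    then obtain a b k where z: "z = \<bar>x (\<tau> b) - x (\<tau> a)\<bar>"
      and ab: "a \<in> {0..\<rho> t}" "b \<in> {0..\<rho> t}"
        "ereal a \<in> {time_ext \<rho> (\<pi> k)..<time_ext \<rho> (\<pi> (Suc k))}"
        "ereal b \<in> {time_ext \<rho> (\<pi> k)..<time_ext \<rho> (\<pi> (Suc k))}" by auto
    have "\<rho> (\<tau> a) = a" "\<rho> (\<tau> b) = b" "0 \<le> \<tau> a" "0 \<le> \<tau> b"
      using ab by (auto simp: inverse_cancel bij_nonneg)
    then have "\<tau> a \<in> {0..t}" "\<tau> b \<in> {0..t}"
        "ereal (\<tau> a) \<in> {\<pi> k..<\<pi> (Suc k)}" "ereal (\<tau> b) \<in> {\<pi> k..<\<pi> (Suc k)}"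
      using ab le[of "\<tau> a"] le[of "\<tau> b"] mem[of "\<tau> a" k] mem[of "\<tau> b" k] by metis+
    then show "z \<in> ?B" unfolding z by blast
  next
    fix z assume "z \<in> ?B"
    then obtain a b k where z: "z = \<bar>x b - x a\<bar>" and ab: "a \<in> {0..t}" "b \<in> {0..t}"
        "ereal a \<in> {\<pi> k..<\<pi> (Suc k)}" "ereal b \<in> {\<pi> k..<\<pi> (Suc k)}" by auto
    have "z = \<bar>(x \<circ> \<tau>) (\<rho> b) - (x \<circ> \<tau>) (\<rho> a)\<bar>" using ab z by (simp add: cancel_inverse)
    moreover have "0 \<le> a" "0 \<le> b" using ab by auto
    ultimately show "z \<in> ?A" using ab le[of a] le[of b] mem[of a k] mem[of b k] by blast
  qed
  then show ?thesis unfolding osc_def tc by simp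
qed

text \<open>
  The substitution \<open>s = \<tau> t\<close> turns the hitting times of \<open>x \<circ> \<tau>\<close> after \<open>\<rho> r\<close> into those of \<open>x\<close> after \<open>r\<close>.
\<close>

lemma lebesgue_partition_compose:
  assumes P: "is_real_partition P" and x: "continuous_on {0..} x"
  shows "lebesgue_partition P (x \<circ> \<tau>) = time_change \<rho> (lebesgue_partition P x)"
proof -
  have "lebesgue_partition P (x \<circ> \<tau>) k = time_ext \<rho> (lebesgue_partition P x k)" for k
  proof (induction k)
    case 0
    then show ?case by (simp add: inverse_zero zero_ereal_def)
  next
    case (Suc k)
    let ?v = "lebesgue_partition P x k"
    let ?S = "{ereal s | s. ?v < ereal s \<and> ereal (x s) \<in> range P \<and> x s \<noteq> x (real_of_ereal ?v)}"
    let ?T = "{ereal t | t. time_ext \<rho> ?v < ereal t \<and> ereal (x (\<tau> t)) \<in> range P \<and>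
                 x (\<tau> t) \<noteq> x (\<tau> (real_of_ereal (time_ext \<rho> ?v)))}"
    have nonneg: "0 \<le> ?v" by (rule lebesgue_partition_nonneg)
    have image: "?T = time_ext \<rho> ` ?S"
    proof (cases "?v = \<infinity>")
      case False
      then obtain r where r: "?v = ereal r" "0 \<le> r" using nonneg by (cases ?v) auto
      have less: "\<rho> r < \<rho> s \<longleftrightarrow> r < s" if "0 \<le> s" for s
        using time_ext_inverse_less_iff[of "ereal r" "ereal s"] r(2) that by simp
      show ?thesis
      proof (intro equalityI subsetI)
        fix z assume "z \<in> ?T"
        then obtain t where t: "z = ereal t" "\<rho> r < t" "ereal (x (\<tau> t)) \<in> range P"
          "x (\<tau> t) \<noteq> x r" using r cancel_inverse by auto
        have t0: "0 \<le> t" using t(2) inverse_nonneg[OF r(2)] by simp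
        then have "r < \<tau> t" using less[of "\<tau> t"] t(2) bij_nonneg inverse_cancel by simp
        then have "ereal (\<tau> t) \<in> ?S" using t r by auto
        moreover have "z = time_ext \<rho> (ereal (\<tau> t))" using t t0 inverse_cancel by simp
        ultimately show "z \<in> time_ext \<rho> ` ?S" by blast
      next
        fix z assume "z \<in> time_ext \<rho> ` ?S"
        then obtain s where s: "z = ereal (\<rho> s)" "r < s" "ereal (x s) \<in> range P" "x s \<noteq> x r"
          using r by auto
        then show "z \<in> ?T" using r less[of s] cancel_inverse by auto
      qed
    qed simp
    have S_nonneg: "0 \<le> z" if "z \<in> ?S" for z
    proof -
      have "?v < z" using that by blast
      with nonneg show ?thesis by (rule order_trans[OF _ less_imp_le])
    qed
    have "Inf ?T = time_ext \<rho> (Inf ?S)"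
      unfolding image by (rule time_ext_inverse_Inf[symmetric]) (rule S_nonneg)
    then show ?case unfolding lebesgue_partition.simps Suc.IH unfolding comp_apply .
  qed
  moreover have "time_change \<rho> (lebesgue_partition P x) k = time_ext \<rho> (lebesgue_partition P x k)" for k
  proof (rule time_change_strict_mono[OF inverse_strict_mono])
    show "lebesgue_partition P x 0 = 0" by simp
  qed (rule lebesgue_partition_strict[OF P x])
  ultimately show ?thesis by (simp add: fun_eq_iff)
qed

end

section \<open>Local times and time changes\<close>

theorem proposition4p2:
  fixes p :: ennreal and x \<tau> :: "real \<Rightarrow> real"
  assumes "1 \<le> p"
    and "continuous_on {0..} x"
    and "mono_on {0..} \<tau>" and "cadlag \<tau>" and "\<tau> 0 = 0"
  shows "(\<forall>\<pi>s :: nat \<Rightarrow> nat \<Rightarrow> ereal.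
            (\<forall>n. is_partition (\<pi>s n)) \<longrightarrow>
            (\<forall>t\<ge>0. (\<lambda>n. osc t x (\<pi>s n)) \<longlonglongrightarrow> 0) \<longrightarrow>
            continuous_on {0..} (x \<circ> \<tau>) \<longrightarrow>
            (\<forall>n. is_partition (time_change \<tau> (\<pi>s n))) \<longrightarrow>
            (\<forall>t\<ge>0. (\<lambda>n. osc (\<tau> t) x (time_change \<tau> (\<pi>s n))) \<longlonglongrightarrow> 0) \<longrightarrow>
            x \<in> local_time_paths p (\<lambda>n. time_change \<tau> (\<pi>s n)) \<longrightarrow>
              (\<forall>t\<ge>0. (\<lambda>n. osc t (x \<circ> \<tau>) (\<pi>s n)) \<longlonglongrightarrow> 0) \<and>
              x \<circ> \<tau> \<in> local_time_paths p \<pi>s \<and>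
              (\<forall>t\<ge>0. AE u in lborel.
                 local_time p \<pi>s (x \<circ> \<tau>) t u =
                 local_time p (\<lambda>n. time_change \<tau> (\<pi>s n)) x (\<tau> t) u))
       \<and> (bij_betw \<tau> {0..} {0..} \<longrightarrow>
            continuous_on {0..} (x \<circ> \<tau>) \<and>
            (\<forall>\<pi> t. is_partition \<pi> \<longrightarrow> 0 \<le> t \<longrightarrow>
               osc (inv_into {0..} \<tau> t) (x \<circ> \<tau>) (time_change (inv_into {0..} \<tau>) \<pi>) = osc t x \<pi>) \<and>
            (\<forall>P. is_real_partition P \<longrightarrow>
               lebesgue_partition P (x \<circ> \<tau>) =
               time_change (inv_into {0..} \<tau>) (lebesgue_partition P x)))"
proof (intro conjI allI impI)
  fix \<pi>s :: "nat \<Rightarrow> nat \<Rightarrow> ereal" and t :: real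
  assume part: "\<forall>n. is_partition (\<pi>s n)" and y: "continuous_on {0..} (x \<circ> \<tau>)"
    and part': "\<forall>n. is_partition (time_change \<tau> (\<pi>s n))"
    and osc': "\<forall>t\<ge>0. (\<lambda>n. osc (\<tau> t) x (time_change \<tau> (\<pi>s n))) \<longlonglongrightarrow> 0"
    and x: "x \<in> local_time_paths p (\<lambda>n. time_change \<tau> (\<pi>s n))"
  have osc: "(\<lambda>n. osc t (x \<circ> \<tau>) (\<pi>s n)) \<longlonglongrightarrow> 0" if t: "0 \<le> t" for t
  proof (rule tendsto_sandwich[OF _ _ tendsto_const])
    show "\<forall>\<^sub>F n in sequentially. 0 \<le> osc t (x \<circ> \<tau>) (\<pi>s n)"
      using osc_nonneg[OF y _ t] part by simp
    show "\<forall>\<^sub>F n in sequentially. osc t (x \<circ> \<tau>) (\<pi>s n) \<le> osc (\<tau> t) x (time_change \<tau> (\<pi>s n))"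
      using osc_compose_le[OF assms(2,3,5) _ _ t] part part' by simp
    show "(\<lambda>n. osc (\<tau> t) x (time_change \<tau> (\<pi>s n))) \<longlonglongrightarrow> 0" using osc' t by simp
  qed
  then show "0 \<le> t \<Longrightarrow> (\<lambda>n. osc t (x \<circ> \<tau>) (\<pi>s n)) \<longlonglongrightarrow> 0" .
  show "x \<circ> \<tau> \<in> local_time_paths p \<pi>s"
    using part by (intro local_time_paths_compose[OF assms(3-5) _ y osc x]) auto
  assume "0 \<le> t"
  \<comment> \<open>Both sides choose a limit of one and the same sequence, so they agree everywhere.\<close>
  then show "AE u in lborel. local_time p \<pi>s (x \<circ> \<tau>) t u =
      local_time p (\<lambda>n. time_change \<tau> (\<pi>s n)) x (\<tau> t) u"
    using part by (simp add: local_time_def discrete_local_time_compose[OF assms(3)])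
next
  assume bij: "bij_betw \<tau> {0..} {0..}"
  show "continuous_on {0..} (x \<circ> \<tau>)"
    using bij by (intro continuous_on_compose mono_bij_continuous[OF assms(3)])
      (auto simp: bij_betw_def assms(2))
  show "osc (inv_into {0..} \<tau> t) (x \<circ> \<tau>) (time_change (inv_into {0..} \<tau>) \<pi>) = osc t x \<pi>"
    if "is_partition \<pi>" "0 \<le> t" for \<pi> t
    by (rule osc_time_change_inverse[OF assms(3,5) bij that])
  show "lebesgue_partition P (x \<circ> \<tau>) =
      time_change (inv_into {0..} \<tau>) (lebesgue_partition P x)" if "is_real_partition P" for P
    by (rule lebesgue_partition_compose[OF assms(3,5) bij that assms(2)])
qed

end
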